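(* Let $k\geq 3$ be an integer. For all sufficiently large integers $n$ (that is, there is an $n_0=n_0(k)$ such that for all $n\ge n_0$), $$\mathrm{sat}^*(n,\mathcal{A}_{k+1})\geq\left(1-\frac{1}{\log_2 k}\right)\frac{kn}{\log_2 k}.$$
   Context: Let $[n]=\{1,\ldots,n\}$ and let $\mathcal{B}_n=(2^{[n]},\subseteq)$ be the $n$-dimensional Boolean lattice, i.e. the poset of all subsets of $[n]$ ordered by inclusion. A family $\mathcal{F}\subseteq 2^{[n]}$ is regarded as a poset under inclusion. A poset $(P,\preceq)$ is an induced subposet of (has an induced copy in) $\mathcal{F}$ if there is an injection $f:P\to\mathcal{F}$ such that $u\preceq v$ if and only if $f(u)\subseteq f(v)$. A family $\mathcal{F}\subseteq 2^{[n]}$ is induced-$\mathcal{P}$-saturated in $\mathcal{B}_n$ if $\mathcal{F}$ contains no induced copy of $\mathcal{P}$, but for every $S\in 2^{[n]}\setminus\mathcal{F}$ the family $\mathcal{F}\cup\{S\}$ contains an induced copy of $\mathcal{P}$. The induced saturation number $\mathrm{sat}^*(n,\mathcal{P})$ is the minimum size of a family that is induced-$\mathcal{P}$-saturated in $\mathcal{B}_n$. $\mathcal{A}_{m}$ denotes the antichain with $m$ elements (the poset on $m$ elements in which no two distinct elements are comparable). *)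

theory Defs
  imports Complex_Main
begin

(* A poset is given by its reflexive order relation r; its carrier is Field r. *)

definition has_induced_copy :: "'a rel \<Rightarrow> nat set set \<Rightarrow> bool" where
  "has_induced_copy r F \<longleftrightarrow>
     (\<exists>f. inj_on f (Field r) \<and> f ` Field r \<subseteq> F \<and>
        (\<forall>u\<in>Field r. \<forall>v\<in>Field r. (u, v) \<in> r \<longleftrightarrow> f u \<subseteq> f v))"

definition induced_saturated :: "nat \<Rightarrow> 'a rel \<Rightarrow> nat set set \<Rightarrow> bool" where
  "induced_saturated n r F \<longleftrightarrow>
     F \<subseteq> Pow {1..n} \<and> \<not> has_induced_copy r F \<and>
     (\<forall>S \<in> Pow {1..n} - F. has_induced_copy r (F \<union> {S}))"

definition sat_star :: "nat \<Rightarrow> 'a rel \<Rightarrow> nat" where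
  "sat_star n r = (LEAST m. \<exists>F. induced_saturated n r F \<and> card F = m)"

definition antichain_poset :: "nat \<Rightarrow> nat rel" where
  "antichain_poset m = Id_on {1..m}"

lemma Field_antichain_poset: "Field (antichain_poset m) = {1..m}"
  by (auto simp: antichain_poset_def Field_def)

lemma partial_order_antichain_poset: "partial_order_on {1..m} (antichain_poset m)"
  by (auto simp: antichain_poset_def partial_order_on_def preorder_on_def refl_on_def
      trans_def antisym_def)

(* The minimum in the definition of sat_star is attained as soon as the poset is nonempty. *)

lemma induced_saturated_exists:
  assumes "Field r \<noteq> {}"
  shows "\<exists>F. induced_saturated n r F"
proof -
  let ?A = "{F. F \<subseteq> Pow {1..n} \<and> \<not> has_induced_copy r F}"
  have fin: "finite ?A"
    by (rule finite_subset[of _ "Pow (Pow {1..n})"]) auto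
  have "{} \<in> ?A"
    using assms by (auto simp: has_induced_copy_def)
  then have "?A \<noteq> {}"
    by (metis empty_iff)
  from finite_has_maximal[OF fin this]
  obtain F where F: "F \<in> ?A" and max: "\<forall>G\<in>?A. F \<subseteq> G \<longrightarrow> F = G"
    by (rule bexE)
  have "has_induced_copy r (F \<union> {S})" if "S \<in> Pow {1..n} - F" for S
  proof (rule ccontr)
    assume "\<not> has_induced_copy r (F \<union> {S})"
    then have "F \<union> {S} \<in> ?A"
      using F that by simp
    then have "F = F \<union> {S}"
      by (rule max[rule_format]) blast
    then show False
      using that by auto
  qed
  then show ?thesis
    using F unfolding induced_saturated_def by (intro exI[of _ F]) simp
qed

lemma sat_star_attained:
  assumes "Field r \<noteq> {}"
  shows "\<exists>F. induced_saturated n r F \<and> card F = sat_star n r"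
proof -
  obtain F where "induced_saturated n r F"
    using induced_saturated_exists[OF assms] by blast
  then have "\<exists>m F. induced_saturated n r F \<and> card F = m"
    by blast
  then show ?thesis
    unfolding sat_star_def by (rule LeastI_ex)
qed

lemma sat_star_le: "induced_saturated n r F \<Longrightarrow> sat_star n r \<le> card F"
  unfolding sat_star_def by (rule Least_le) blast

end

theory Submission
  imports Defs
begin

text \<open>
  Let \<open>F\<close> be a saturated family for the antichain on \<open>k + 1\<close> points.  Leave out \<open>\<emptyset>\<close> and
  \<open>[n]\<close>, which are comparable to every set, and call the rest \<open>G\<close>.  It has no antichain of
  size \<open>k + 1\<close>, so Dilworth's theorem (\<open>dilworth\<close>) splits it into \<open>k\<close> chains.  Extend each chain by
  \<open>\<emptyset>\<close> and \<open>[n]\<close>, so that it climbs from level \<open>0\<close> to level \<open>n\<close>.  If consecutive members of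
  every extended chain differ by at most \<open>D\<close> elements, then every chain has at least \<open>n / D - 1\<close>
  members, and \<open>F\<close> has at least \<open>kn / D - k\<close>.

  It remains to bound the gaps.  Saturation forces \<open>F\<close> to contain all sets strictly inside a gap
  from \<open>X\<close> to \<open>Y\<close> (\<open>saturated_gap_full\<close>): a missing set would complete an antichain of size
  \<open>k + 1\<close>, whose other \<open>k\<close> members meet all \<open>k\<close> chains, yet every member of the chain with the
  gap is comparable to a set inside it.  Hence the other \<open>k - 1\<close> chains share
  \<open>2 ^ d - 2\<close> sets, where \<open>d\<close> is the size of \<open>Y - X\<close>.  For an arbitrary decomposition this only
  bounds a binomial coefficient, which is slightly too weak.  So the decomposition is chosen
  with as few free windows as possible, that is, intervals of consecutive levels in which some chain
  has no member, counted separately for every chain.  Then each other chain has at most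
  two sets inside the gap: given three, \<open>Z\<^sub>1 \<subset> Z \<subset> Z\<^sub>2\<close>, moving \<open>Z\<close> to the chain with the gap opens
  at most the windows around level \<open>|Z|\<close> that lie strictly between \<open>|Z\<^sub>1|\<close> and \<open>|Z\<^sub>2|\<close>, but closes the larger
  collection of such windows strictly between \<open>|X|\<close> and \<open>|Y|\<close> (\<open>recolour_middle\<close>).  Therefore
  \<open>2 ^ d - 2 \<le> 2 (k - 1)\<close>, that is, \<open>d \<le> log\<^sub>2 k + 1\<close> (\<open>gap_bound\<close>).

  With \<open>L = log\<^sub>2 k\<close> this gives \<open>kn / (L + 1) - k\<close> as a lower bound for the size of \<open>F\<close>, and since
  \<open>1 / (L + 1) - (L - 1) / L\<^sup>2 = 1 / (L\<^sup>2 (L + 1)) > 0\<close>, the subtracted constant is absorbed as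
  soon as \<open>n \<ge> L\<^sup>2 (L + 1)\<close>.
\<close>

section \<open>Antichains and chain decompositions\<close>

definition antichain :: "'a::order set \<Rightarrow> bool" where
  "antichain A \<longleftrightarrow> (\<forall>x\<in>A. \<forall>y\<in>A. x \<le> y \<longrightarrow> x = y)"

text \<open>
  Colour classes may be empty, so this is a decomposition into at most \<^term>\<open>k\<close> chains.
\<close>

definition chain_colouring :: "nat \<Rightarrow> 'a::order set \<Rightarrow> ('a \<Rightarrow> nat) \<Rightarrow> bool" where
  "chain_colouring k P col \<longleftrightarrow>
     (\<forall>x\<in>P. col x < k) \<and> (\<forall>x\<in>P. \<forall>y\<in>P. col x = col y \<longrightarrow> x \<le> y \<or> y \<le> x)"

lemma antichain_subset: "antichain A \<Longrightarrow> B \<subseteq> A \<Longrightarrow> antichain B"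
  by (auto simp: antichain_def)

lemma chain_colouring_lessD: "chain_colouring k P col \<Longrightarrow> x \<in> P \<Longrightarrow> col x < k"
  by (simp add: chain_colouring_def)

lemma chain_colouring_comparableD:
  "chain_colouring k P col \<Longrightarrow> x \<in> P \<Longrightarrow> y \<in> P \<Longrightarrow> col x = col y \<Longrightarrow> x \<le> y \<or> y \<le> x"
  by (simp add: chain_colouring_def)

lemma antichain_rainbow:
  assumes "chain_colouring k P col" "A \<subseteq> P" "antichain A" "card A = k"
  shows "col ` A = {..<k}"
proof -
  have inj: "inj_on col A"
  proof (rule inj_onI)
    fix x y assume "x \<in> A" "y \<in> A" "col x = col y"
    moreover from this have "x \<le> y \<or> y \<le> x"
      using assms(1,2) chain_colouring_comparableD by blast
    ultimately show "x = y"
      using assms(3) by (auto simp: antichain_def)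
  qed
  have "col ` A \<subseteq> {..<k}"
    using assms(1,2) by (auto simp: chain_colouring_def)
  moreover have "card (col ` A) = card {..<k}"
    using inj assms(4) by (simp add: card_image)
  ultimately show ?thesis
    by (intro card_subset_eq) auto
qed

lemma chain_colouring_extend:
  assumes "chain_colouring j (P - K) col" "\<And>x y. x \<in> K \<Longrightarrow> y \<in> K \<Longrightarrow> x \<le> y \<or> y \<le> x"
  shows "chain_colouring (Suc j) P (\<lambda>x. if x \<in> K then j else col x)"
proof -
  have "col x < j" if "x \<in> P" "x \<notin> K" for x
    using assms(1) that by (auto simp: chain_colouring_def)
  then show ?thesis
    using assms unfolding chain_colouring_def by (auto simp: less_Suc_eq)
qed

text \<open>
  The hard direction of Dilworth's theorem, by Galvin's induction.  Remove a maximal element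
  \<^term>\<open>a\<close> and decompose the rest.  If the rest still has an antichain of size \<^term>\<open>k\<close>, then
  every such antichain meets every chain, and the highest elements \<open>t i\<close> of the chains that lie in
  such antichains form an antichain themselves.  It cannot be enlarged by \<^term>\<open>a\<close>, so
  some \<open>t i\<close> is below \<^term>\<open>a\<close>.  The chain of \<^term>\<open>a\<close> and of everything up to \<open>t i\<close> in its
  colour class then meets all antichains of size \<^term>\<open>k\<close>, and what remains is handled by induction.
\<close>

theorem dilworth:
  fixes P :: "'a::order set"
  assumes "finite P" "\<And>A. A \<subseteq> P \<Longrightarrow> antichain A \<Longrightarrow> card A \<le> k"
  shows "\<exists>col. chain_colouring k P col"
  using assms
proof (induction P arbitrary: k rule: finite_psubset_induct)
  case (psubset P)
  show ?case
  proof (cases "P = {}")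
    case True
    then show ?thesis by (simp add: chain_colouring_def)
  next
    case False
    obtain a where a: "a \<in> P" and a_max: "\<And>y. y \<in> P \<Longrightarrow> a \<le> y \<Longrightarrow> a = y"
      using finite_has_maximal[OF psubset.hyps False] by blast
    have "card {a} \<le> k"
      using a by (intro psubset.prems) (auto simp: antichain_def)
    then obtain j where k: "k = Suc j"
      by (cases k) auto
    have remove_chain: ?thesis
      if K: "a \<in> K" "\<And>x y. x \<in> K \<Longrightarrow> y \<in> K \<Longrightarrow> x \<le> y \<or> y \<le> x"
        and no: "\<And>A. A \<subseteq> P - K \<Longrightarrow> antichain A \<Longrightarrow> card A \<noteq> k" for K
    proof -
      have "card A \<le> j" if "A \<subseteq> P - K" "antichain A" for A
      proof -
        have "card A \<le> k"
          using that by (intro psubset.prems) auto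
        then show ?thesis using no[OF that] k by simp
      qed
      moreover have "P - K \<subset> P"
        using a K(1) by blast
      ultimately obtain col where "chain_colouring j (P - K) col"
        using psubset.IH[of "P - K" j] by blast
      then show ?thesis
        using chain_colouring_extend[OF _ K(2)] k by blast
    qed
    show ?thesis
    proof (cases "\<exists>A. A \<subseteq> P - {a} \<and> antichain A \<and> card A = k")
      case False
      then show ?thesis
        by (intro remove_chain[of "{a}"]) auto
    next
      case True
      then obtain A0 where A0: "A0 \<subseteq> P - {a}" "antichain A0" "card A0 = k"
        by blast
      have "P - {a} \<subset> P" using a by blast
      then obtain col where col: "chain_colouring k (P - {a}) col"
        using psubset.IH[of "P - {a}" k] psubset.prems by blast
      \<comment> \<open>the elements that lie in some antichain of maximal size\<close>
      define W where "W = \<Union>{A. A \<subseteq> P - {a} \<and> antichain A \<and> card A = k}"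
      have W_sub: "W \<subseteq> P - {a}"
        by (auto simp: W_def)
      have top: "\<exists>x. x \<in> W \<and> col x = i \<and> (\<forall>y\<in>W. col y = i \<longrightarrow> y \<le> x)" if "i < k" for i
      proof -
        let ?Wi = "{x \<in> W. col x = i}"
        have "i \<in> col ` A0"
          using antichain_rainbow[OF col A0] that by simp
        then have "?Wi \<noteq> {}"
          using A0 by (auto simp: W_def)
        moreover have "finite ?Wi"
          using finite_subset[OF W_sub] psubset.hyps by simp
        ultimately obtain x where x: "x \<in> ?Wi" "\<forall>y\<in>?Wi. x \<le> y \<longrightarrow> x = y"
          using finite_has_maximal[of ?Wi] by blast
        have "y \<le> x" if "y \<in> ?Wi" for y
        proof -
          have "x \<le> y \<or> y \<le> x"
            using chain_colouring_comparableD[OF col, of x y] x(1) that W_sub by auto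
          then show ?thesis using x that by auto
        qed
        then show ?thesis using x(1) by blast
      qed
      then obtain t where t: "\<And>i. i < k \<Longrightarrow> t i \<in> W" "\<And>i. i < k \<Longrightarrow> col (t i) = i"
        "\<And>i y. i < k \<Longrightarrow> y \<in> W \<Longrightarrow> col y = i \<Longrightarrow> y \<le> t i"
        by metis
      have t_incomp: "i = i'" if le: "i < k" "i' < k" "t i \<le> t i'" for i i'
      proof -
        obtain A where A: "A \<subseteq> P - {a}" "antichain A" "card A = k" "t i' \<in> A"
          using t(1)[OF le(2)] by (auto simp: W_def)
        have "i \<in> col ` A"
          using antichain_rainbow[OF col A(1-3)] le(1) by simp
        then obtain y where y: "y \<in> A" "col y = i" by blast
        have "y \<in> W" using A y by (auto simp: W_def)
        from order_trans[OF t(3)[OF le(1) this y(2)] le(3)] have "y = t i'"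
          using A(2,4) y(1) by (auto simp: antichain_def)
        then show ?thesis using t(2)[OF le(2)] y(2) by simp
      qed
      have "inj_on t {..<k}"
        using t(2) by (metis inj_onI lessThan_iff)
      then have card_t: "card (t ` {..<k}) = k"
        by (simp add: card_image)
      have t_P: "t ` {..<k} \<subseteq> P - {a}"
        using t(1) W_sub by auto
      have "\<exists>i<k. t i \<le> a"
      proof (rule ccontr)
        assume no: "\<not> ?thesis"
        have "antichain (insert a (t ` {..<k}))"
          using no t_incomp a_max t_P unfolding antichain_def by blast
        then have "card (insert a (t ` {..<k})) \<le> k"
          using t_P a by (intro psubset.prems) auto
        moreover have "a \<notin> t ` {..<k}" using t_P by blast
        ultimately show False using card_t by simp
      qed
      then obtain i where i: "i < k" "t i \<le> a" by blast
      define K where "K = insert a {z \<in> P - {a}. col z = i \<and> z \<le> t i}"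
      show ?thesis
      proof (rule remove_chain)
        show "a \<in> K" by (simp add: K_def)
        show "x \<le> y \<or> y \<le> x" if "x \<in> K" "y \<in> K" for x y
          using that i(2) chain_colouring_comparableD[OF col, of x y]
          by (auto simp: K_def intro: order_trans)
        show "card A \<noteq> k" if A: "A \<subseteq> P - K" "antichain A" for A
        proof
          assume cA: "card A = k"
          have AP: "A \<subseteq> P - {a}" using A(1) by (auto simp: K_def)
          have "i \<in> col ` A"
            using antichain_rainbow[OF col AP A(2) cA] i(1) by simp
          then obtain z where z: "z \<in> A" "col z = i" by blast
          have "z \<in> W" using z AP A(2) cA by (auto simp: W_def)
          then have "z \<in> K"
            using t(3)[OF i(1)] z AP by (auto simp: K_def)
          then show False using z A(1) by auto
        qed
      qed
    qed
  qed
qed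

section \<open>Decompositions with few free windows\<close>

text \<open>
  The potential that measures how well a decomposition spreads over the levels of the cube: a
  gap of length \<open>d\<close> between two sets of a colour class contributes the \<open>d (d - 1) / 2\<close> windows of levels inside it,
  so long gaps are penalised quadratically.
\<close>

definition free_windows :: "nat \<Rightarrow> nat \<Rightarrow> nat set set \<Rightarrow> (nat set \<Rightarrow> nat) \<Rightarrow> (nat \<times> nat \<times> nat) set"
  where
  "free_windows n k G col =
     {(c, s, t). c < k \<and> s \<le> t \<and> t \<le> n \<and> (\<forall>A\<in>G. col A = c \<longrightarrow> card A \<notin> {s..t})}"

lemma finite_free_windows: "finite (free_windows n k G col)"
  by (rule finite_subset[of _ "{..<k} \<times> {..n} \<times> {..n}"]) (auto simp: free_windows_def)

text \<open>
  Handing the middle set to the class with the gap pays off because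
  both gaps that it leaves behind and merges lie strictly inside the gap that it cuts.
\<close>

lemma recolour_middle:
  assumes G: "G \<subseteq> Pow {1..n}" and col: "chain_colouring k G col"
    and c: "c < k" and Y: "Y \<subseteq> {1..n}"
    and gap: "\<And>A. A \<in> G \<Longrightarrow> col A = c \<Longrightarrow> A \<subseteq> X \<or> Y \<subseteq> A"
    and inG: "Z1 \<in> G" "Z \<in> G" "Z2 \<in> G"
    and same: "col Z1 = c'" "col Z = c'" "col Z2 = c'"
    and sub: "X \<subset> Z1" "Z1 \<subset> Z" "Z \<subset> Z2" "Z2 \<subset> Y"
  shows "chain_colouring k G (col(Z := c))"
    and "card (free_windows n k G (col(Z := c))) < card (free_windows n k G col)"
proof -
  have XZY: "X \<subseteq> Z" "Z \<subseteq> Y" using sub by auto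
  show "chain_colouring k G (col(Z := c))"
    unfolding chain_colouring_def
  proof (intro conjI ballI impI)
    show "(col(Z := c)) x < k" if "x \<in> G" for x
      using that c chain_colouring_lessD[OF col] by simp
    have comp: "A \<subseteq> Z \<or> Z \<subseteq> A" if "A \<in> G" "col A = c" for A
      using gap[OF that] XZY by blast
    show "x \<subseteq> y \<or> y \<subseteq> x" if "x \<in> G" "y \<in> G" "(col(Z := c)) x = (col(Z := c)) y" for x y
      using that comp[of x] comp[of y] chain_colouring_comparableD[OF col that(1,2)]
      by (auto split: if_splits)
  qed
  have ne: "c' \<noteq> c"
    using gap[of Z] inG same sub by auto
  have finY: "finite Y" using Y finite_subset by blast
  have cards: "card X < card Z1" "card Z1 < card Z" "card Z < card Z2" "card Z2 < card Y"
    using sub finY by (meson psubset_card_mono finite_subset psubset_imp_subset)+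
  have gap_card: "card A \<le> card X \<or> card Y \<le> card A" if "A \<in> G" "col A = c" for A
  proof -
    have "finite A"
      using G that(1) finite_subset[of A "{1..n}"] by auto
    moreover have "finite X"
      using XZY finY finite_subset[of X Y] by blast
    ultimately show ?thesis using gap[OF that] by (auto intro: card_mono)
  qed
  have cardY: "card Y \<le> n" using card_mono[OF _ Y] by simp
  \<comment> \<open>A window of the class that loses \<open>Z\<close> may become free; it is matched with the same window of
    the class that gains \<open>Z\<close>, which was free before.  All other windows are kept.\<close>
  define f where "f = (\<lambda>(i, s, t). (if i = c' \<and> card Z \<in> {s..t} then c else i, s :: nat, t :: nat))"
  have win: "card Z1 < s \<and> t < card Z2"
    if "(c', s, t) \<in> free_windows n k G (col(Z := c))" "card Z \<in> {s..t}" for s t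
  proof -
    have "card Z1 \<notin> {s..t}" "card Z2 \<notin> {s..t}"
      using that(1) inG same sub ne by (auto simp: free_windows_def)
    then show ?thesis using that(2) cards by auto
  qed
  have noc: "card Z \<notin> {s..t}" if "(c, s, t) \<in> free_windows n k G (col(Z := c))" for s t
    using that inG by (auto simp: free_windows_def)
  have inj: "inj_on f (free_windows n k G (col(Z := c)))"
    using noc ne by (intro inj_onI) (auto simp: f_def split: if_splits)
  \<comment> \<open>A window that was free but is matched with nothing, since it starts at the level of \<open>Z1\<close>.\<close>
  let ?w = "(c, card Z1, card Z)"
  have w: "?w \<in> free_windows n k G col"
    using c cards cardY gap_card by (fastforce simp: free_windows_def)
  have sub_img: "f ` free_windows n k G (col(Z := c)) \<subseteq> free_windows n k G col - {?w}"
  proof (clarsimp simp del: fun_upd_apply)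
    fix i s t assume ist: "(i, s, t) \<in> free_windows n k G (col(Z := c))"
    show "f (i, s, t) \<in> free_windows n k G col \<and> f (i, s, t) \<noteq> ?w"
    proof (cases "i = c' \<and> card Z \<in> {s..t}")
      case True
      have st: "card Z1 < s" "t < card Z2" using win ist True by auto
      have "card A \<notin> {s..t}" if "A \<in> G" "col A = c" for A
        using gap_card[OF that] st cards by auto
      then have "(c, s, t) \<in> free_windows n k G col"
        using ist c by (auto simp: free_windows_def)
      then show ?thesis using True st by (auto simp: f_def)
    next
      case False
      have "(i, s, t) \<in> free_windows n k G col"
        using ist False same(2) by (auto simp: free_windows_def split: if_splits)
      moreover have "(i, s, t) \<noteq> ?w"
        using noc[of s t] ist cards by auto
      ultimately show ?thesis using False by (auto simp: f_def)
    qed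
  qed
  have "card (free_windows n k G (col(Z := c))) \<le> card (free_windows n k G col - {?w})"
    by (rule card_inj_on_le[OF inj sub_img]) (simp add: finite_free_windows)
  also have "\<dots> < card (free_windows n k G col)"
    using w finite_free_windows by (intro psubset_card_mono) auto
  finally show "card (free_windows n k G (col(Z := c))) < card (free_windows n k G col)" .
qed

lemma three_chain:
  assumes "finite B" "2 < card B" "\<And>x y. x \<in> B \<Longrightarrow> y \<in> B \<Longrightarrow> x \<subseteq> y \<or> y \<subseteq> x"
  shows "\<exists>x\<in>B. \<exists>y\<in>B. \<exists>z\<in>B. x \<subset> y \<and> y \<subset> z"
proof -
  have "B \<noteq> {}" using assms(2) by auto
  obtain x where x: "x \<in> B" "\<forall>y\<in>B. y \<subseteq> x \<longrightarrow> x = y"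
    using finite_has_minimal[OF assms(1) \<open>B \<noteq> {}\<close>] by blast
  obtain z where z: "z \<in> B" "\<forall>y\<in>B. z \<subseteq> y \<longrightarrow> z = y"
    using finite_has_maximal[OF assms(1) \<open>B \<noteq> {}\<close>] by blast
  have "card {x, z} \<le> 2" by (simp add: card_insert_if)
  then have "\<not> B \<subseteq> {x, z}"
    using assms(2) card_mono[of "{x, z}" B] by auto
  then obtain y where "y \<in> B" "y \<noteq> x" "y \<noteq> z" by blast
  then show ?thesis
    using x z assms(3) by (metis psubsetI)
qed

lemma card_open_interval:
  assumes "finite Y" "X \<subset> Y"
  shows "card {S. X \<subset> S \<and> S \<subset> Y} + 2 = 2 ^ (card Y - card X)"
proof -
  have "bij_betw (\<lambda>S. X \<union> S) (Pow (Y - X)) {S. X \<subseteq> S \<and> S \<subseteq> Y}"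
    using assms by (intro bij_betw_byWitness[where f' = "\<lambda>S. S - X"]) auto
  then have "card {S. X \<subseteq> S \<and> S \<subseteq> Y} = 2 ^ card (Y - X)"
    using assms(1) by (metis bij_betw_same_card card_Pow finite_Diff)
  moreover have "card (Y - X) = card Y - card X"
    using assms by (intro card_Diff_subset) (auto intro: finite_subset)
  moreover have "{S. X \<subseteq> S \<and> S \<subseteq> Y} = insert X (insert Y {S. X \<subset> S \<and> S \<subset> Y})"
    using assms(2) by auto
  moreover have "finite {S. X \<subset> S \<and> S \<subset> Y}"
    using assms(1) by (auto intro: finite_subset[of _ "Pow Y"])
  ultimately show ?thesis
    using assms(2) by auto
qed

text \<open>
  In a decomposition with the fewest free windows, each of the other \<open>k - 1\<close> chains has at
  most two of the \<open>2 ^ d - 2\<close> sets inside a gap, by \<open>recolour_middle\<close>.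
\<close>

lemma gap_bound:
  assumes G: "G \<subseteq> Pow {1..n}" and col: "chain_colouring k G col"
    and opt: "\<And>col'. chain_colouring k G col' \<Longrightarrow>
      card (free_windows n k G col) \<le> card (free_windows n k G col')"
    and c: "c < k" and Y: "Y \<subseteq> {1..n}" and XY: "X \<subset> Y"
    and gap: "\<And>A. A \<in> G \<Longrightarrow> col A = c \<Longrightarrow> A \<subseteq> X \<or> Y \<subseteq> A"
    and full: "\<And>S. X \<subset> S \<Longrightarrow> S \<subset> Y \<Longrightarrow> S \<in> G"
  shows "2 ^ (card Y - card X) \<le> 2 * k"
proof -
  let ?I = "{S. X \<subset> S \<and> S \<subset> Y}"
  have finY: "finite Y" using Y finite_subset by blast
  have finI: "finite ?I"
    using finY by (auto intro: finite_subset[of _ "Pow Y"])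
  have two: "card {S \<in> ?I. col S = c'} \<le> 2" for c'
  proof (rule ccontr)
    assume many: "\<not> ?thesis"
    have "\<exists>x\<in>{S \<in> ?I. col S = c'}. \<exists>y\<in>{S \<in> ?I. col S = c'}. \<exists>z\<in>{S \<in> ?I. col S = c'}. x \<subset> y \<and> y \<subset> z"
    proof (rule three_chain)
      show "x \<subseteq> y \<or> y \<subseteq> x" if "x \<in> {S \<in> ?I. col S = c'}" "y \<in> {S \<in> ?I. col S = c'}" for x y
        using chain_colouring_comparableD[OF col, of x y] full that by simp
      show "finite {S \<in> ?I. col S = c'}" by (rule finite_subset[OF _ finI]) auto
      show "2 < card {S \<in> ?I. col S = c'}" using many by simp
    qed
    then obtain x y z where I: "x \<in> {S \<in> ?I. col S = c'}" "y \<in> {S \<in> ?I. col S = c'}"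
        "z \<in> {S \<in> ?I. col S = c'}"
      and xyz: "x \<subset> y" "y \<subset> z"
      by (elim bexE conjE)
    have cols: "col x = c'" "col y = c'" "col z = c'"
      using I by simp_all
    have "x \<in> G" "y \<in> G" "z \<in> G" "X \<subset> x" "z \<subset> Y"
      using I full by simp_all
    note rec = recolour_middle[OF G col c Y gap this(1-3) cols this(4) xyz this(5)]
    show False using opt[OF rec(1)] rec(2) by simp
  qed
  have I_eq: "?I = (\<Union>c'\<in>{..<k} - {c}. {S \<in> ?I. col S = c'})"
  proof -
    have "col S \<in> {..<k} - {c}" if "S \<in> ?I" for S
      using gap[of S] full[of S] chain_colouring_lessD[OF col, of S] that by auto
    then show ?thesis by blast
  qed
  have "card ?I = card (\<Union>c'\<in>{..<k} - {c}. {S \<in> ?I. col S = c'})"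
    by (rule arg_cong[OF I_eq])
  also have "\<dots> \<le> (\<Sum>c'\<in>{..<k} - {c}. card {S \<in> ?I. col S = c'})"
    by (rule card_UN_le) simp
  also have "\<dots> \<le> (\<Sum>c'\<in>{..<k} - {c}. 2)"
    by (intro sum_mono two)
  also have "\<dots> = 2 * (k - 1)"
    using c by simp
  finally have "card ?I \<le> 2 * (k - 1)" .
  then show ?thesis
    using card_open_interval[OF finY XY] c by simp
qed

section \<open>Size of saturated families\<close>

lemma has_induced_copy_antichain_iff:
  "has_induced_copy (antichain_poset m) F \<longleftrightarrow> (\<exists>A\<subseteq>F. finite A \<and> card A = m \<and> antichain A)"
proof
  assume "has_induced_copy (antichain_poset m) F"
  then obtain f where f: "inj_on f {1..m}" "f ` {1..m} \<subseteq> F"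
    "\<forall>u\<in>{1..m}. \<forall>v\<in>{1..m}. (u, v) \<in> antichain_poset m \<longleftrightarrow> f u \<subseteq> f v"
    unfolding has_induced_copy_def Field_antichain_poset by blast
  have "antichain (f ` {1..m})"
    using f(3) by (auto simp: antichain_def antichain_poset_def)
  then show "\<exists>A\<subseteq>F. finite A \<and> card A = m \<and> antichain A"
    using f(1,2) by (intro exI[of _ "f ` {1..m}"]) (simp add: card_image)
next
  assume "\<exists>A\<subseteq>F. finite A \<and> card A = m \<and> antichain A"
  then obtain A where A: "A \<subseteq> F" "finite A" "card A = m" "antichain A" by blast
  obtain f where f: "bij_betw f {1..m} A"
    using ex_bij_betw_nat_finite_1[OF A(2)] A(3) by blast
  have "(u, v) \<in> antichain_poset m \<longleftrightarrow> f u \<subseteq> f v" if "u \<in> {1..m}" "v \<in> {1..m}" for u v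
  proof
    assume "f u \<subseteq> f v"
    moreover have "f u \<in> A" "f v \<in> A"
      using f that bij_betwE by blast+
    ultimately have "f u = f v"
      using A(4) by (simp add: antichain_def)
    then have "u = v"
      using bij_betw_imp_inj_on[OF f] that inj_onD by metis
    then show "(u, v) \<in> antichain_poset m"
      using that(1) unfolding antichain_poset_def by blast
  next
    assume "(u, v) \<in> antichain_poset m"
    then show "f u \<subseteq> f v" by (auto simp: antichain_poset_def)
  qed
  then show "has_induced_copy (antichain_poset m) F"
    using f A(1) unfolding has_induced_copy_def Field_antichain_poset bij_betw_def
    by (intro exI[of _ f]) auto
qed

text \<open>
  The antichain completed by a missing set \<^term>\<open>S\<close> avoids \<open>\<emptyset>\<close> and the full set
  because both are comparable to \<^term>\<open>S\<close>.
\<close>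

lemma saturated_missing_set:
  assumes sat: "induced_saturated n (antichain_poset (k + 1)) F"
    and S: "S \<subseteq> {1..n}" "S \<notin> F"
  shows "\<exists>A\<subseteq>F - {{}, {1..n}}. antichain A \<and> card A = k \<and> (\<forall>B\<in>A. \<not> B \<subseteq> S \<and> \<not> S \<subseteq> B)"
proof -
  have "has_induced_copy (antichain_poset (k + 1)) (F \<union> {S})"
    using sat S by (simp add: induced_saturated_def)
  then obtain A where A: "A \<subseteq> F \<union> {S}" "finite A" "card A = k + 1" "antichain A"
    unfolding has_induced_copy_antichain_iff by blast
  have "\<not> A \<subseteq> F"
    using sat A unfolding induced_saturated_def has_induced_copy_antichain_iff by blast
  then have SA: "S \<in> A" using A(1) by blast
  have card: "card (A - {S}) = k"
    using SA A(2,3) by simp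
  have inc: "\<not> B \<subseteq> S \<and> \<not> S \<subseteq> B" if "B \<in> A - {S}" for B
    using A(4) SA that by (auto simp: antichain_def)
  have "A - {S} \<subseteq> F - {{}, {1..n}}"
    using A(1) inc S(1) by blast
  then show ?thesis
    using card inc antichain_subset[OF A(4), of "A - {S}"] by blast
qed

text \<open>
  An antichain of \<^term>\<open>k\<close> sets meets every one of the \<^term>\<open>k\<close> chains.  If a set inside a gap
  of colour \<^term>\<open>c\<close> were missing, the antichain that it would complete could not have a member
  of colour \<^term>\<open>c\<close>, since all sets of that colour lie below or above the whole gap.
\<close>

lemma saturated_gap_full:
  assumes sat: "induced_saturated n (antichain_poset (k + 1)) F"
    and col: "chain_colouring k (F - {{}, {1..n}}) col"
    and c: "c < k" and Y: "Y \<subseteq> {1..n}"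
    and gap: "\<And>A. A \<in> F - {{}, {1..n}} \<Longrightarrow> col A = c \<Longrightarrow> A \<subseteq> X \<or> Y \<subseteq> A"
    and S: "X \<subset> S" "S \<subset> Y"
  shows "S \<in> F - {{}, {1..n}}"
proof -
  have "S \<in> F"
  proof (rule ccontr)
    assume "S \<notin> F"
    moreover have "S \<subseteq> {1..n}" using S(2) Y by blast
    ultimately obtain A where A: "A \<subseteq> F - {{}, {1..n}}" "antichain A" "card A = k"
      and inc: "\<forall>B\<in>A. \<not> B \<subseteq> S \<and> \<not> S \<subseteq> B"
      using saturated_missing_set[OF sat] by blast
    have "c \<in> col ` A"
      using antichain_rainbow[OF col A] c by simp
    then obtain B where B: "B \<in> A" "col B = c" by blast
    then have "B \<subseteq> X \<or> Y \<subseteq> B" using gap A(1) by blast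
    then show False using inc B(1) S by blast
  qed
  moreover have "S \<noteq> {}" "S \<noteq> {1..n}"
    using S Y by blast+
  ultimately show ?thesis by simp
qed

text \<open>Every step from \<^term>\<open>i - 1\<close> to \<^term>\<open>i\<close> is charged to the upper end of the gap that contains it.\<close>

lemma covering_by_gaps:
  fixes T :: "nat set"
  assumes "finite T" "\<And>i. i \<in> {1..n} \<Longrightarrow> \<exists>t\<in>T. i \<le> t \<and> t < i + D"
  shows "n \<le> card T * D"
proof -
  have "{1..n} \<subseteq> (\<Union>t\<in>T. {t + 1 - D..t})"
    using assms(2) by force
  then have "card {1..n} \<le> card (\<Union>t\<in>T. {t + 1 - D..t})"
    using assms(1) by (intro card_mono) auto
  also have "\<dots> \<le> (\<Sum>t\<in>T. card {t + 1 - D..t})"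
    by (rule card_UN_le[OF assms(1)])
  also have "\<dots> \<le> (\<Sum>t\<in>T. D)"
    by (intro sum_mono) auto
  finally show ?thesis by simp
qed

text \<open>
  Summing over the colour classes: each one, together with the empty and the full set, climbs from
  level \<open>0\<close> to level \<^term>\<open>n\<close> in steps of at most \<^term>\<open>D\<close>.
\<close>

lemma saturated_family_size:
  assumes sat: "induced_saturated n (antichain_poset (k + 1)) F"
    and D: "\<And>d. 2 ^ d \<le> 2 * k \<Longrightarrow> d \<le> D"
  shows "k * n \<le> (card F + k) * D"
proof -
  define G where "G = F - {{}, {1..n}}"
  have F: "F \<subseteq> Pow {1..n}" using sat by (simp add: induced_saturated_def)
  then have finF: "finite F" by (rule finite_subset) simp
  have G: "G \<subseteq> Pow {1..n}" and finG: "finite G"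
    using F finF by (auto simp: G_def)
  have "card A \<le> k" if "A \<subseteq> G" "antichain A" for A
  proof (rule ccontr)
    assume "\<not> ?thesis"
    then obtain B where B: "B \<subseteq> A" "card B = k + 1"
      by (metis Suc_eq_plus1 not_less_eq_eq obtain_subset_with_card_n)
    then have "finite B" by (intro card_ge_0_finite) simp
    then have "has_induced_copy (antichain_poset (k + 1)) F"
      using B that antichain_subset[OF that(2) B(1)]
      unfolding has_induced_copy_antichain_iff by (intro exI[of _ B]) (auto simp: G_def)
    then show False using sat by (simp add: induced_saturated_def)
  qed
  then have "\<exists>col. chain_colouring k G col"
    using dilworth[OF finG] by blast
  then obtain col where col: "chain_colouring k G col"
    and opt: "\<And>col'. chain_colouring k G col' \<Longrightarrow>
      card (free_windows n k G col) \<le> card (free_windows n k G col')"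
    using ex_has_least_nat[of "chain_colouring k G" _ "\<lambda>col. card (free_windows n k G col)"] by blast
  have class_bound: "n \<le> (card {A \<in> G. col A = c} + 1) * D" if c: "c < k" for c
  proof -
    let ?C = "{A \<in> G. col A = c}"
    define C where "C = {{}, {1..n}} \<union> ?C"
    have finC: "finite ?C" "finite C" using finG by (simp_all add: C_def)
    have C_sub: "A \<subseteq> {1..n}" if "A \<in> C" for A
      using that G by (auto simp: C_def)
    have C_comp: "A \<subseteq> B \<or> B \<subseteq> A" if "A \<in> C" "B \<in> C" for A B
    proof (cases "A \<in> ?C \<and> B \<in> ?C")
      case True
      then show ?thesis using chain_colouring_comparableD[OF col, of A B] by simp
    next
      case False
      then have "A \<in> {{}, {1..n}} \<or> B \<in> {{}, {1..n}}"
        using that unfolding C_def by blast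
      then show ?thesis using C_sub[OF that(1)] C_sub[OF that(2)] by blast
    qed
    \<comment> \<open>Upper ends of gaps are never the empty set, so it is left out of the count.\<close>
    have "n \<le> card (card ` insert {1..n} ?C) * D"
    proof (rule covering_by_gaps)
      show "finite (card ` insert {1..n} ?C)" using finC by simp
      fix i assume i: "i \<in> {1..n}"
      let ?L = "{A \<in> C. card A < i}" and ?U = "{A \<in> C. i \<le> card A}"
      have "{} \<in> ?L" "{1..n} \<in> ?U"
        using i by (simp_all add: C_def)
      \<comment> \<open>\<open>X\<close> and \<open>Y\<close> are the ends of the gap that contains the step from level \<open>i - 1\<close> to \<open>i\<close>.\<close>
      then have "?L \<noteq> {}" "?U \<noteq> {}" by blast+
      then obtain X Y where X: "X \<in> C" "card X < i" "\<And>A. A \<in> ?L \<Longrightarrow> X \<subseteq> A \<Longrightarrow> X = A"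
        and Y: "Y \<in> C" "i \<le> card Y" "\<And>A. A \<in> ?U \<Longrightarrow> A \<subseteq> Y \<Longrightarrow> Y = A"
        using finite_has_maximal[of ?L] finite_has_minimal[of ?U] finC(2) by auto
      have XY: "X \<subset> Y"
      proof -
        have "finite X" using finite_subset[OF C_sub[OF X(1)]] by simp
        then have "\<not> Y \<subseteq> X"
          using X(2) Y(2) card_mono[of X Y] by linarith
        then show ?thesis using C_comp[OF X(1) Y(1)] by blast
      qed
      have gap: "A \<subseteq> X \<or> Y \<subseteq> A" if "A \<in> G" "col A = c" for A
      proof -
        have AC: "A \<in> C" using that by (simp add: C_def)
        show ?thesis
        proof (cases "card A < i")
          case True
          then show ?thesis using X(3)[of A] C_comp[OF X(1) AC] AC by auto
        next
          case False
          then show ?thesis using Y(3)[of A] C_comp[OF Y(1) AC] AC by auto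
        qed
      qed
      have full: "S \<in> G" if "X \<subset> S" "S \<subset> Y" for S
        using saturated_gap_full[OF sat col[unfolded G_def] c C_sub[OF Y(1)] gap[unfolded G_def] that]
        by (simp add: G_def)
      have "2 ^ (card Y - card X) \<le> 2 * k"
        by (rule gap_bound[OF G col opt c C_sub[OF Y(1)] XY gap full])
      then have "card Y - card X \<le> D" by (rule D)
      then show "\<exists>t\<in>card ` insert {1..n} ?C. i \<le> t \<and> t < i + D"
        using X(2) Y(1,2) by (intro bexI[of _ "card Y"]) (auto simp: C_def)
    qed
    also have "\<dots> \<le> card (insert {1..n} ?C) * D"
      using finC(1) by (intro mult_right_mono card_image_le) auto
    also have "\<dots> \<le> (card ?C + 1) * D"
      using finC(1) by (intro mult_right_mono) (auto simp: card_insert_if)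
    finally show ?thesis .
  qed
  have G_eq: "G = (\<Union>c<k. {A \<in> G. col A = c})"
    using chain_colouring_lessD[OF col] by auto
  have "card (\<Union>c<k. {A \<in> G. col A = c}) = (\<Sum>c<k. card {A \<in> G. col A = c})"
    using finG by (intro card_UN_disjoint) auto
  with arg_cong[OF G_eq, of card] have cardG: "card G = (\<Sum>c<k. card {A \<in> G. col A = c})"
    by (rule trans)
  have "k * n = (\<Sum>c<k. n)" by simp
  also have "\<dots> \<le> (\<Sum>c<k. (card {A \<in> G. col A = c} + 1) * D)"
    using class_bound by (intro sum_mono) auto
  also have "\<dots> = (card G + k) * D"
    by (simp only: sum_distrib_right[symmetric] sum.distrib cardG) simp
  also have "\<dots> \<le> (card F + k) * D"
    using card_mono[OF finF, of G] by (intro mult_right_mono) (auto simp: G_def)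
  finally show ?thesis .
qed

theorem theorem7:
  fixes k :: nat
  assumes "k \<ge> 3"
  shows "\<exists>n0::nat. \<forall>n\<ge>n0.
    real (sat_star n (antichain_poset (k + 1)))
      \<ge> (1 - 1 / log 2 (real k)) * (real k * real n / log 2 (real k))"
proof -
  define L where "L = log 2 (real k)"
  have L: "L > 1"
    using assms by (simp add: L_def)
  define D where "D = nat \<lfloor>L + 1\<rfloor>"
  have D: "d \<le> D" if "2 ^ d \<le> 2 * k" for d
  proof -
    have "real (2 ^ d) \<le> real (2 * k)"
      using that of_nat_le_iff by blast
    then have "log 2 (2 ^ d) \<le> log 2 (2 * real k)"
      using assms by (intro log_mono) auto
    then have "real d \<le> L + 1"
      using assms by (simp add: L_def log_mult log_nat_power)
    then show ?thesis
      unfolding D_def by (rule le_nat_floor)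
  qed
  have DL: "real D \<le> L + 1"
    using L by (simp add: D_def)
  obtain n0 :: nat where n0: "L\<^sup>2 * (L + 1) \<le> real n0"
    using real_arch_simple by blast
  show ?thesis
  proof (intro exI[of _ n0] allI impI)
    fix n assume "n \<ge> n0"
    then have n: "L\<^sup>2 * (L + 1) \<le> real n" using n0 by linarith
    have "Field (antichain_poset (k + 1)) \<noteq> {}"
      by (simp add: Field_antichain_poset)
    from sat_star_attained[OF this, of n]
    obtain F where F: "induced_saturated n (antichain_poset (k + 1)) F"
      "card F = sat_star n (antichain_poset (k + 1))"
      by (elim exE conjE)
    let ?s = "real (sat_star n (antichain_poset (k + 1)))"
    have "k * n \<le> (card F + k) * D"
      by (rule saturated_family_size[OF F(1) D])
    then have "real (k * n) \<le> real ((card F + k) * D)"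
      using of_nat_le_iff by blast
    then have "real k * real n \<le> (?s + real k) * real D"
      by (simp add: F(2))
    also have "\<dots> \<le> (?s + real k) * (L + 1)"
      using DL by (intro mult_left_mono) auto
    finally have up: "real k * real n \<le> (?s + real k) * (L + 1)" .
    \<comment> \<open>\<open>L\<^sup>2 - 1 < L\<^sup>2\<close> leaves a surplus \<open>k * n\<close>, which pays for the additive error.\<close>
    have "(L - 1) * (real k * real n) * (L + 1) = L\<^sup>2 * (real k * real n) - real k * real n"
      by (simp add: algebra_simps power2_eq_square)
    also have "\<dots> \<le> L\<^sup>2 * ((?s + real k) * (L + 1)) - real k * (L\<^sup>2 * (L + 1))"
      using up n by (intro diff_mono mult_left_mono) auto
    also have "\<dots> = L\<^sup>2 * ?s * (L + 1)"
      by (simp add: algebra_simps)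
    finally have "(L - 1) * (real k * real n) \<le> L\<^sup>2 * ?s"
      by (rule mult_right_le_imp_le) (use L in linarith)
    then have "(L - 1) * (real k * real n) / L\<^sup>2 \<le> ?s"
      using L by (subst pos_divide_le_eq) (simp_all add: mult.commute)
    moreover have "(1 - 1 / L) * (real k * real n / L) = (L - 1) * (real k * real n) / L\<^sup>2"
      using L by (simp add: field_simps power2_eq_square)
    ultimately show "?s \<ge> (1 - 1 / log 2 (real k)) * (real k * real n / log 2 (real k))"
      by (simp add: L_def)
  qed
qed

end
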